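(* Let $d\ge1$, $n\ge0$, and let $\sigma$ be a legal prefix with thresholds $b_1<\cdots<b_d$, bands $B_0,\ldots,B_{d-1}$ of sizes $\mathbf p=(p_0,\ldots,p_{d-1})$, and stack $\mathcal S(\sigma)=(I_1,\ldots,I_s)$ with sizes $L=(\ell_1,\ldots,\ell_s)$. (a) The stack consists of the unread values above $b_d$, so the ordered layout $$B_0<b_1<B_1<b_2<\cdots<b_{d-1}<B_{d-1}<b_d<I_1<\cdots<I_s$$ holds (empty blocks being allowed). (b) The legal moves from $\sigma$, and their effect on $(\mathbf p,L)$, are the following. A value of $B_i$ with $i<d-1$ having $h$ unread values of $B_i$ below it is a non-trigger move to $(T_{i,h}(\mathbf p),L)$. A value of $B_{d-1}$ having $h$ unread values of $B_{d-1}$ below it is a merger to $(U_h(\mathbf p),\mathrm{nz}(\ell_1+\delta_h,\ell_2,\ldots))$. A value of $I_1$ of local rank $r$ is a split to $(\mathbf p,\mathrm{nz}(r-1,\ell_1-r,\ell_2,\ldots))$. No other letter is legal.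
   Context: Write $[n]=\{1,\ldots,n\}$. A $d$-trigger of a word with distinct letters is the last entry of an increasing subsequence of length $d$ (positions need not be adjacent). Scan states. Fix $d\geq1$ and $n$. A scan state is a pair $(\sigma,S)$. Here $\sigma$ is a word with distinct letters from $[n]$ (the read prefix); letters of $[n]$ not in $\sigma$ are unread. Let $q$ be the least $d$-trigger of $\sigma$, and $q=n+d$ (a virtual value above every letter) if there is none. The stack $S=(I_1,\ldots,I_s)$ is a list of nonempty sets with $I_1<I_2<\cdots<I_s$ (all elements of $I_j$ smaller than all elements of $I_{j+1}$) whose union is the set of unread letters larger than $q$. The initial state is $(\varepsilon,\varnothing)$. For an unread letter $x$, reading $x$ is a legal move, leading to $(\sigma x,S')$, in the following cases. - Merger: $x$ is a $d$-trigger of $\sigma x$ and $x<q$. With $E$ the set of unread letters strictly between $x$ and $q$, $S'=(E\cup I_1,I_2,\ldots,I_s)$, where $I_1=\varnothing$ if $s=0$, with an empty set deleted. - Split: $x$ is a $d$-trigger of $\sigma x$, $x>q$, and $x\in I_1$. Then $S'=(I_1^{<x},I_1^{>x},I_2,\ldots,I_s)$ (elements of $I_1$ below, respectively above, $x$), with empty sets deleted. - Non-trigger move: $x$ is not a $d$-trigger of $\sigma x$. Then $S'=S$. Reading any other unread letter is illegal. A word (prefix) $\sigma$ is legal if the initial state reaches some $(\sigma,S)$ by legal moves; then $S$ is determined by $\sigma$ and denoted $\mathcal S(\sigma)$. Thresholds and bands. For $1\le j\le d$, $b_j$ is the smallest final entry of an increasing subsequence of length $j$ of $\sigma$, with the virtual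 value $b_j=n+j$ if there is none; one has $b_1<\cdots<b_d$. Band $B_0$ is the set of unread values below $b_1$, and for $1\le i<d$ band $B_i$ is the set of unread values strictly between $b_i$ and $b_{i+1}$; $p_i=|B_i|$. The local rank of $x\in I_1$ is $|\{y\in I_1:y\le x\}|$. $\mathrm{nz}$ of a list deletes its zero entries. For an empty stack, $\ell_1$ is read as $0$ and its tail as empty. For $0\le i<d-1$ and $0\le h<p_i$, $$T_{i,h}(\mathbf p)=(p_0,\ldots,p_{i-1},h,p_{i+1}+p_i-1-h,p_{i+2},\ldots,p_{d-1}),$$ and for $0\le h<p_{d-1}$, $U_h(\mathbf p)=(p_0,\ldots,p_{d-2},h)$ and $\delta_h=p_{d-1}-1-h$ (for $d=1$, $U_h((p_0))=(h)$). *)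

theory Defs
  imports Main "HOL-Library.Sublist"
begin

text \<open>Words are lists of natural numbers; the alphabet [n] is \<open>{1..n}\<close>.\<close>

definition is_trigger :: "nat \<Rightarrow> nat list \<Rightarrow> nat \<Rightarrow> bool" where
  "is_trigger j w x \<longleftrightarrow>
     (\<exists>u. subseq (u @ [x]) w \<and> length (u @ [x]) = j \<and> sorted_wrt (<) (u @ [x]))"

definition unread :: "nat \<Rightarrow> nat list \<Rightarrow> nat set" where
  "unread n \<sigma> = {1..n} - set \<sigma>"

text \<open>The threshold \<open>b\<^sub>j\<close>. For \<open>j = d\<close> this is the least \<open>d\<close>-trigger \<open>q\<close>, including its virtual
  value \<open>n + d\<close>.\<close>

definition threshold :: "nat \<Rightarrow> nat list \<Rightarrow> nat \<Rightarrow> nat" where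
  "threshold n \<sigma> j =
     (if \<exists>x. is_trigger j \<sigma> x then (LEAST x. is_trigger j \<sigma> x) else n + j)"

definition set_before :: "nat set \<Rightarrow> nat set \<Rightarrow> bool" where
  "set_before A B \<longleftrightarrow> (\<forall>a\<in>A. \<forall>b\<in>B. a < b)"

type_synonym state = "nat list \<times> nat set list"

definition scan_state :: "nat \<Rightarrow> nat \<Rightarrow> state \<Rightarrow> bool" where
  "scan_state d n = (\<lambda>(\<sigma>, S).
     distinct \<sigma> \<and> set \<sigma> \<subseteq> {1..n} \<and>
     {} \<notin> set S \<and> sorted_wrt set_before S \<and>
     \<Union>(set S) = {x \<in> unread n \<sigma>. threshold n \<sigma> d < x})"

definition head_or :: "'a \<Rightarrow> 'a list \<Rightarrow> 'a" where
  "head_or z xs = (case xs of [] \<Rightarrow> z | x # _ \<Rightarrow> x)"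

definition delete_empty :: "nat set list \<Rightarrow> nat set list" where
  "delete_empty S = filter (\<lambda>I. I \<noteq> {}) S"

datatype move_kind = Merger | Split | Non_Trigger

text \<open>\<open>legal_move d n k x s t\<close>: from the scan state \<open>s\<close>, reading \<open>x\<close> is a legal move of kind \<open>k\<close>
  leading to \<open>t\<close>. That \<open>t\<close> is again a scan state is a consequence, not a requirement.\<close>

inductive legal_move :: "nat \<Rightarrow> nat \<Rightarrow> move_kind \<Rightarrow> nat \<Rightarrow> state \<Rightarrow> state \<Rightarrow> bool"
  for d n :: nat where
  merger:
    "\<lbrakk>scan_state d n (\<sigma>, S); x \<in> unread n \<sigma>;
      is_trigger d (\<sigma> @ [x]) x; x < threshold n \<sigma> d;
      E = {y \<in> unread n \<sigma>. x < y \<and> y < threshold n \<sigma> d}\<rbrakk>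
     \<Longrightarrow> legal_move d n Merger x (\<sigma>, S)
          (\<sigma> @ [x], delete_empty ((E \<union> head_or {} S) # tl S))"
| split:
    "\<lbrakk>scan_state d n (\<sigma>, S); x \<in> unread n \<sigma>;
      is_trigger d (\<sigma> @ [x]) x; threshold n \<sigma> d < x; S = I # S'; x \<in> I\<rbrakk>
     \<Longrightarrow> legal_move d n Split x (\<sigma>, S)
          (\<sigma> @ [x], delete_empty ({y \<in> I. y < x} # {y \<in> I. x < y} # S'))"
| non_trigger:
    "\<lbrakk>scan_state d n (\<sigma>, S); x \<in> unread n \<sigma>; \<not> is_trigger d (\<sigma> @ [x]) x\<rbrakk>
     \<Longrightarrow> legal_move d n Non_Trigger x (\<sigma>, S) (\<sigma> @ [x], S)"

inductive reachable :: "nat \<Rightarrow> nat \<Rightarrow> state \<Rightarrow> bool" for d n :: nat where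
  initial: "reachable d n ([], [])"
| step: "\<lbrakk>reachable d n s; legal_move d n k x s t\<rbrakk> \<Longrightarrow> reachable d n t"

definition legal_prefix :: "nat \<Rightarrow> nat \<Rightarrow> nat list \<Rightarrow> bool" where
  "legal_prefix d n \<sigma> \<longleftrightarrow> (\<exists>S. reachable d n (\<sigma>, S))"

definition stack :: "nat \<Rightarrow> nat \<Rightarrow> nat list \<Rightarrow> nat set list" where
  "stack d n \<sigma> = (THE S. reachable d n (\<sigma>, S))"

definition stack_sizes :: "nat \<Rightarrow> nat \<Rightarrow> nat list \<Rightarrow> nat list" where
  "stack_sizes d n \<sigma> = map card (stack d n \<sigma>)"

definition band :: "nat \<Rightarrow> nat list \<Rightarrow> nat \<Rightarrow> nat set" where
  "band n \<sigma> i =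
     {x \<in> unread n \<sigma>. (i = 0 \<or> threshold n \<sigma> i < x) \<and> x < threshold n \<sigma> (i + 1)}"

definition band_sizes :: "nat \<Rightarrow> nat \<Rightarrow> nat list \<Rightarrow> nat list" where
  "band_sizes d n \<sigma> = map (\<lambda>i. card (band n \<sigma> i)) [0..<d]"

definition local_rank :: "nat set \<Rightarrow> nat \<Rightarrow> nat" where
  "local_rank I x = card {y \<in> I. y \<le> x}"

definition nz :: "nat list \<Rightarrow> nat list" where
  "nz L = filter (\<lambda>l. l \<noteq> 0) L"

text \<open>The truncated subtractions below are exact in the intended range, \<open>h < p ! i\<close> for \<open>T_op\<close>
  and \<open>h < last p\<close> for \<open>merge_gain\<close>.\<close>

definition T_op :: "nat \<Rightarrow> nat \<Rightarrow> nat list \<Rightarrow> nat list" where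
  "T_op i h p = p[i := h, i + 1 := p ! (i + 1) + (p ! i - 1 - h)]"

definition U_op :: "nat \<Rightarrow> nat list \<Rightarrow> nat list" where
  "U_op h p = butlast p @ [h]"

definition merge_gain :: "nat \<Rightarrow> nat list \<Rightarrow> nat" where
  "merge_gain h p = last p - 1 - h"

text \<open>The blocks \<open>B\<^sub>0, {b\<^sub>1}, B\<^sub>1, {b\<^sub>2}, \<dots>, B\<^bsub>d-1\<^esub>, {b\<^sub>d}, I\<^sub>1, \<dots>, I\<^sub>s\<close>. Since blocks may be empty,
  the layout has to be read as \<open>set_before\<close> for all pairs, not only for neighbours.\<close>

definition layout :: "nat \<Rightarrow> nat \<Rightarrow> nat list \<Rightarrow> nat set list" where
  "layout d n \<sigma> =
     concat (map (\<lambda>i. [band n \<sigma> i, {threshold n \<sigma> (i + 1)}]) [0..<d]) @ stack d n \<sigma>"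

end

theory Submission
  imports Defs
begin

text \<open>
  Appending an unread letter \<open>x\<close> moves at most one threshold. The letter ends an increasing
  subsequence of length \<open>j\<close> exactly when \<open>j = 1\<close> or \<open>b\<^bsub>j-1\<^esub> < x\<close>, and it lowers \<open>b\<^sub>j\<close> exactly when
  moreover \<open>x < b\<^sub>j\<close> (\<open>threshold_snoc\<close>). Since the thresholds increase strictly
  (\<open>threshold_less_Suc\<close>), a letter of band \<open>B\<^sub>i\<close> replaces \<open>b\<^bsub>i+1\<^esub>\<close> and no other threshold, as in patience
  sorting, while a letter above \<open>b\<^sub>d\<close> changes none of \<open>b\<^sub>1, \<dots>, b\<^sub>d\<close>. This one fact gives both halves
  of the description of the moves.

  The kind of move is read off from \<open>j = d\<close>: letters below \<open>b\<^bsub>d-1\<^esub>\<close> are non-triggers, letters of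
  \<open>B\<^bsub>d-1\<^esub>\<close> are triggers below \<open>b\<^sub>d\<close>, and letters of \<open>I\<^sub>1\<close> are triggers above \<open>b\<^sub>d\<close>. For the effect
  on sizes, lowering \<open>b\<^bsub>i+1\<^esub>\<close> to \<open>x\<close> keeps the part of \<open>B\<^sub>i\<close> below \<open>x\<close> in \<open>B\<^sub>i\<close> and hands the part above
  \<open>x\<close> to the next block (\<open>band_snoc_same\<close>, \<open>band_snoc_next\<close>). For \<open>i = d - 1\<close> the next block is the
  first stack set: the set \<open>E\<close> of a merger is exactly the part of \<open>B\<^bsub>d-1\<^esub>\<close> above \<open>x\<close>.

  That the stack has the required shape is an invariant of the three moves
  (\<open>legal_move_preserves_scan_state\<close>). It is a function of the prefix because, once the letter
  is given, the three kinds of move exclude each other and each determines its result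
  (\<open>legal_move_deterministic\<close>, \<open>reachable_unique\<close>); this is what allows \<open>stack\<close> to be computed from
  any single legal move (\<open>legal_moves_of_letter\<close>).
\<close>

section \<open>Triggers and thresholds\<close>

lemma subseq_singleton_right: "subseq v [x] \<longleftrightarrow> v = [] \<or> v = [x]"
  by (cases v; cases "tl v") auto

lemma subseq_snoc_iff:
  "subseq (u @ [y]) (w @ [x]) \<longleftrightarrow> subseq (u @ [y]) w \<or> y = x \<and> subseq u w"
proof
  assume "subseq (u @ [y]) (w @ [x])"
  then obtain a b where "u @ [y] = a @ b" "subseq a w" "b = [] \<or> b = [x]"
    by (auto simp: subseq_append_iff subseq_singleton_right)
  then show "subseq (u @ [y]) w \<or> y = x \<and> subseq u w" by auto
qed (auto intro: subseq_rev_drop_many)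

lemma is_trigger_in_set: "is_trigger j w x \<Longrightarrow> x \<in> set w"
  by (fastforce simp: is_trigger_def dest: list_emb_set)

lemma is_trigger_Suc_below:
  assumes "is_trigger (Suc (Suc j)) w x"
  shows "\<exists>z<x. is_trigger (Suc j) w z"
proof -
  from assms obtain u where u: "subseq (u @ [x]) w" "length u = Suc j" "sorted_wrt (<) (u @ [x])"
    by (auto simp: is_trigger_def)
  then obtain v z where v: "u = v @ [z]" by (metis length_Suc_conv_rev)
  have "subseq (v @ [z]) w"
    using u(1) v list_emb_appendD[of "(=)" "v @ [z]" "[x]" w]
    by (auto intro: subseq_rev_drop_many)
  with u v show ?thesis
    by (auto simp: is_trigger_def sorted_wrt_append)
qed

text \<open>A new trigger must use the appended letter as its last entry, so deleting that letter leaves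
  either nothing or an increasing subsequence ending in a smaller trigger. The case \<open>j = 0\<close> is
  separate because no letter is a \<open>0\<close>-trigger.\<close>

lemma is_trigger_snoc_iff:
  "is_trigger (Suc j) (w @ [x]) y \<longleftrightarrow>
     is_trigger (Suc j) w y \<or> y = x \<and> (j = 0 \<or> (\<exists>z<x. is_trigger j w z))"
proof -
  have "(\<exists>u. subseq u w \<and> length u = j \<and> sorted_wrt (<) (u @ [x])) \<longleftrightarrow>
        j = 0 \<or> (\<exists>z<x. is_trigger j w z)"
  proof
    assume "\<exists>u. subseq u w \<and> length u = j \<and> sorted_wrt (<) (u @ [x])"
    then obtain u where u: "subseq u w" "length u = j" "sorted_wrt (<) (u @ [x])" by blast
    show "j = 0 \<or> (\<exists>z<x. is_trigger j w z)"
    proof (cases u rule: rev_cases)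
      case (snoc v z)
      with u show ?thesis by (auto simp: is_trigger_def sorted_wrt_append)
    qed (use u in simp)
  next
    assume "j = 0 \<or> (\<exists>z<x. is_trigger j w z)"
    then show "\<exists>u. subseq u w \<and> length u = j \<and> sorted_wrt (<) (u @ [x])"
    proof
      assume "\<exists>z<x. is_trigger j w z"
      then obtain v z where "z < x" "subseq (v @ [z]) w" "length (v @ [z]) = j"
        "sorted_wrt (<) (v @ [z])"
        by (auto simp: is_trigger_def)
      then show ?thesis
        by (intro exI[of _ "v @ [z]"]) (auto simp: sorted_wrt_append)
    qed auto
  qed
  moreover have "is_trigger (Suc j) (w @ [x]) y \<longleftrightarrow> is_trigger (Suc j) w y \<or>
      y = x \<and> (\<exists>u. subseq u w \<and> length u = j \<and> sorted_wrt (<) (u @ [x]))"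
    unfolding is_trigger_def subseq_snoc_iff by auto
  ultimately show ?thesis by simp
qed

lemma threshold_le: "is_trigger j w x \<Longrightarrow> threshold n w j \<le> x"
  by (auto simp: threshold_def intro: Least_le)

lemma is_trigger_threshold: "\<exists>x. is_trigger j w x \<Longrightarrow> is_trigger j w (threshold n w j)"
  by (auto simp: threshold_def intro: LeastI)

text \<open>For letters of the alphabet the virtual values are harmless: they exceed \<open>n\<close>, so a comparison
  \<open>b\<^sub>j < x\<close> always comes from a genuine trigger.\<close>

lemma threshold_less_iff:
  assumes "x \<le> n"
  shows "threshold n w j < x \<longleftrightarrow> (\<exists>z<x. is_trigger j w z)"
proof
  assume less: "threshold n w j < x"
  with assms have "\<exists>z. is_trigger j w z"
    by (auto simp: threshold_def split: if_splits)
  with less show "\<exists>z<x. is_trigger j w z"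
    using is_trigger_threshold by blast
qed (use threshold_le le_less_trans in blast)

lemma threshold_eqI:
  assumes "is_trigger j w x" "\<And>y. is_trigger j w y \<Longrightarrow> x \<le> y"
  shows "threshold n w j = x"
  using assms by (auto simp: threshold_def intro: Least_equality)

lemma threshold_cong:
  assumes "\<And>y. is_trigger j w y \<longleftrightarrow> is_trigger j w' y"
  shows "threshold n w j = threshold n w' j"
proof -
  have "is_trigger j w = is_trigger j w'" using assms by blast
  then show ?thesis by (simp add: threshold_def)
qed

lemma threshold_le_virtual:
  assumes "set w \<subseteq> {1..n}"
  shows "threshold n w j \<le> n + j"
proof (cases "\<exists>x. is_trigger j w x")
  case True
  then have "threshold n w j \<in> set w"
    using is_trigger_threshold is_trigger_in_set by blast
  with assms show ?thesis by fastforce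
qed (simp add: threshold_def)

text \<open>Dropping the last entry of an increasing subsequence ending in \<open>b\<^bsub>j+1\<^esub>\<close> leaves a smaller
  \<open>j\<close>-trigger. If \<open>b\<^bsub>j+1\<^esub>\<close> is virtual, it exceeds \<open>n + j\<close>, which bounds \<open>b\<^sub>j\<close>.\<close>

lemma threshold_less_Suc:
  assumes "set w \<subseteq> {1..n}" "1 \<le> j"
  shows "threshold n w j < threshold n w (Suc j)"
proof (cases "\<exists>x. is_trigger (Suc j) w x")
  case True
  then have "is_trigger (Suc j) w (threshold n w (Suc j))"
    by (rule is_trigger_threshold)
  with \<open>1 \<le> j\<close> obtain z where "z < threshold n w (Suc j)" "is_trigger j w z"
    using is_trigger_Suc_below[of "j - 1"] by auto
  then show ?thesis using threshold_le le_less_trans by blast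
next
  case False
  then have "threshold n w (Suc j) = n + Suc j" by (simp add: threshold_def)
  with threshold_le_virtual[OF assms(1), of j] show ?thesis by simp
qed

lemma threshold_mono:
  assumes "set w \<subseteq> {1..n}" "1 \<le> i" "i \<le> j"
  shows "threshold n w i \<le> threshold n w j"
  using assms(3)
proof (induction rule: dec_induct)
  case (step j)
  with threshold_less_Suc[OF assms(1), of j] assms(2) show ?case by simp
qed simp

text \<open>A threshold is a read letter or exceeds \<open>n\<close>. Hence the strict inequalities that define the bands
  leave no unread letter out.\<close>

lemma threshold_not_unread:
  assumes "x \<in> unread n w" "1 \<le> j"
  shows "threshold n w j \<noteq> x"
proof (cases "\<exists>x. is_trigger j w x")
  case True
  then have "threshold n w j \<in> set w"
    using is_trigger_threshold is_trigger_in_set by blast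
  with assms show ?thesis by (auto simp: unread_def)
qed (use assms in \<open>auto simp: threshold_def unread_def\<close>)

text \<open>As \<open>x\<close> is new, it ends no subsequence of \<open>w\<close>; an increasing sequence of length \<open>j - 1\<close> that \<open>x\<close> can
  extend exists as soon as the one with the smallest last entry can be extended.\<close>

lemma new_letter_trigger_iff:
  assumes "x \<in> unread n w" "1 \<le> j"
  shows "is_trigger j (w @ [x]) x \<longleftrightarrow> j = 1 \<or> threshold n w (j - 1) < x"
proof -
  obtain i where j: "j = Suc i" using assms(2) by (cases j) auto
  have "x \<notin> set w" "x \<le> n" using assms(1) by (auto simp: unread_def)
  then have "\<not> is_trigger j w x" using is_trigger_in_set by blast
  with \<open>x \<le> n\<close> show ?thesis by (auto simp: j is_trigger_snoc_iff threshold_less_iff)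
qed

text \<open>A letter that is not a \<open>j\<close>-trigger lies below \<open>b\<^bsub>j-1\<^esub>\<close>, hence also below \<open>b\<^sub>j\<close>: for \<open>j = d\<close>, a
  non-trigger move touches neither the stack nor \<open>b\<^sub>d\<close>.\<close>

lemma non_trigger_below_threshold:
  assumes "set w \<subseteq> {1..n}" "x \<in> unread n w" "1 \<le> j" "\<not> is_trigger j (w @ [x]) x"
  shows "j \<noteq> 1" "\<not> threshold n w (j - 1) < x" "x < threshold n w j"
proof -
  show *: "j \<noteq> 1" "\<not> threshold n w (j - 1) < x"
    using new_letter_trigger_iff[OF assms(2,3)] assms(4) by auto
  have "threshold n w (j - 1) < threshold n w (Suc (j - 1))"
    using * assms(3) by (intro threshold_less_Suc[OF assms(1)]) auto
  with * assms(3) show "x < threshold n w j" by simp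
qed

lemma threshold_snoc:
  assumes "x \<in> unread n w" "1 \<le> j"
  shows "threshold n (w @ [x]) j =
    (if (j = 1 \<or> threshold n w (j - 1) < x) \<and> x < threshold n w j then x else threshold n w j)"
proof -
  obtain i where j: "j = Suc i" using assms(2) by (cases j) auto
  have x: "x \<notin> set w" "x \<le> n" using assms(1) by (auto simp: unread_def)
  let ?c = "j = 1 \<or> threshold n w (j - 1) < x"
  have snoc: "is_trigger j (w @ [x]) y \<longleftrightarrow> is_trigger j w y \<or> y = x \<and> ?c" for y
    using x(2) by (simp add: j is_trigger_snoc_iff threshold_less_iff)
  show ?thesis
  proof (cases ?c)
    case False
    then show ?thesis using threshold_cong[of j "w @ [x]" w n] snoc by auto
  next
    case c: True
    show ?thesis
    proof (cases "x < threshold n w j")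
      case True
      have "threshold n (w @ [x]) j = x"
      proof (rule threshold_eqI)
        show "is_trigger j (w @ [x]) x" using snoc c by blast
        show "x \<le> y" if "is_trigger j (w @ [x]) y" for y
          using that snoc True threshold_le[of j w y n] by auto
      qed
      with c True show ?thesis by simp
    next
      case False
      with threshold_not_unread[OF assms] have less: "threshold n w j < x" by simp
      then have "\<exists>z. is_trigger j w z" using threshold_less_iff[OF x(2)] by blast
      then have "is_trigger j w (threshold n w j)" by (rule is_trigger_threshold)
      with less have "threshold n (w @ [x]) j = threshold n w j"
        by (intro threshold_eqI) (auto simp: snoc intro: threshold_le)
      with False show ?thesis by simp
    qed
  qed
qed

section \<open>Bands\<close>

lemma unread_snoc: "unread n (w @ [x]) = unread n w - {x}"
  by (auto simp: unread_def)

lemma finite_unread [simp]: "finite (unread n w)"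
  by (simp add: unread_def)

lemma finite_band [simp]: "finite (band n w i)"
  by (simp add: band_def)

lemma unread_below_threshold_in_band:
  assumes "x \<in> unread n w" "1 \<le> j" "x < threshold n w j"
  shows "\<exists>i<j. x \<in> band n w i"
  using assms(2,3)
proof (induction rule: dec_induct)
  case base
  with assms(1) show ?case by (auto simp: band_def)
next
  case (step j)
  show ?case
  proof (cases "x < threshold n w j")
    case True
    with step.IH show ?thesis using less_SucI by blast
  next
    case False
    with threshold_not_unread[OF assms(1) step.hyps(1)] have "threshold n w j < x" by simp
    with step.prems assms(1) have "x \<in> band n w j" by (simp add: band_def)
    then show ?thesis by blast
  qed
qed

text \<open>In \<open>B\<^sub>i\<close> the two conditions of \<open>threshold_snoc\<close> hold together only for \<open>j = i + 1\<close>: for smaller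
  \<open>j\<close> the letter is above \<open>b\<^sub>j\<close>, for larger \<open>j\<close> it is below \<open>b\<^bsub>j-1\<^esub>\<close>.\<close>

lemma threshold_snoc_band:
  assumes "set w \<subseteq> {1..n}" "x \<in> band n w i" "1 \<le> j"
  shows "threshold n (w @ [x]) j = (if j = Suc i then x else threshold n w j)"
proof -
  have x: "x \<in> unread n w" "i = 0 \<or> threshold n w i < x" "x < threshold n w (Suc i)"
    using assms(2) by (auto simp: band_def)
  consider "j = Suc i" | "j \<le> i" | "Suc i < j" by linarith
  then show ?thesis
  proof cases
    case 1
    with x show ?thesis using threshold_snoc[OF x(1) assms(3)] by auto
  next
    case 2
    with threshold_mono[OF assms(1,3) 2] x(2) assms(3) show ?thesis
      by (auto simp: threshold_snoc[OF x(1) assms(3)])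
  next
    case 3
    then have "threshold n w (Suc i) \<le> threshold n w (j - 1)"
      by (intro threshold_mono[OF assms(1)]) auto
    with 3 x(3) show ?thesis
      by (auto simp: threshold_snoc[OF x(1) assms(3)])
  qed
qed

lemma threshold_snoc_above:
  assumes "set w \<subseteq> {1..n}" "x \<in> unread n w" "threshold n w d < x" "1 \<le> j" "j \<le> d"
  shows "threshold n (w @ [x]) j = threshold n w j"
  using threshold_mono[OF assms(1,4,5)] assms(3) by (simp add: threshold_snoc[OF assms(2,4)])

lemma band_snoc_same:
  assumes "set w \<subseteq> {1..n}" "x \<in> band n w i"
  shows "band n (w @ [x]) i = {y \<in> band n w i. y < x}"
  using assms threshold_snoc_band[OF assms, of i] threshold_snoc_band[OF assms, of "Suc i"]
  by (cases "i = 0") (auto simp: band_def unread_snoc)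

text \<open>Lowering the boundary \<open>b\<^bsub>i+1\<^esub>\<close> to \<open>x\<close> releases the letters of \<open>B\<^sub>i\<close> above \<open>x\<close> into \<open>B\<^bsub>i+1\<^esub>\<close>; no letter
  is lost at the old boundary, because a threshold is never unread.\<close>

lemma band_snoc_next:
  assumes "set w \<subseteq> {1..n}" "x \<in> band n w i"
  shows "band n (w @ [x]) (Suc i) = {y \<in> band n w i. x < y} \<union> band n w (Suc i)"
proof -
  have x: "x \<in> unread n w" "i = 0 \<or> threshold n w i < x" "x < threshold n w (Suc i)"
    using assms(2) by (auto simp: band_def)
  have "threshold n w (Suc i) < threshold n w (Suc (Suc i))"
    by (rule threshold_less_Suc[OF assms(1)]) simp
  moreover have "threshold n (w @ [x]) (Suc i) = x"
      "threshold n (w @ [x]) (Suc (Suc i)) = threshold n w (Suc (Suc i))"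
    using threshold_snoc_band[OF assms] by auto
  ultimately show ?thesis
    using x threshold_not_unread[of _ n w "Suc i"]
    by (fastforce simp: band_def unread_snoc)
qed

lemma band_snoc_other:
  assumes "set w \<subseteq> {1..n}" "x \<in> band n w i" "k \<noteq> i" "k \<noteq> Suc i"
  shows "band n (w @ [x]) k = band n w k"
proof -
  have x: "x \<in> unread n w" "i = 0 \<or> threshold n w i < x" "x < threshold n w (Suc i)"
    using assms(2) by (auto simp: band_def)
  have "x \<notin> band n w k"
  proof (cases "k < i")
    case True
    with threshold_mono[OF assms(1), of "Suc k" i] x show ?thesis by (auto simp: band_def)
  next
    case False
    with assms(3) threshold_mono[OF assms(1), of "Suc i" k] x show ?thesis
      by (auto simp: band_def)
  qed
  moreover have "threshold n (w @ [x]) (Suc k) = threshold n w (Suc k)"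
    using threshold_snoc_band[OF assms(1,2), of "Suc k"] assms(3) by simp
  moreover have "k = 0 \<or> threshold n (w @ [x]) k = threshold n w k"
    using threshold_snoc_band[OF assms(1,2), of k] assms(4) by (cases k) auto
  ultimately show ?thesis by (auto simp: band_def unread_snoc)
qed

lemma band_snoc_above:
  assumes "set w \<subseteq> {1..n}" "x \<in> unread n w" "threshold n w d < x" "k < d"
  shows "band n (w @ [x]) k = band n w k"
proof -
  have "threshold n (w @ [x]) (Suc k) = threshold n w (Suc k)"
    and "k = 0 \<or> threshold n (w @ [x]) k = threshold n w k"
    using threshold_snoc_above[OF assms(1-3), of "Suc k"]
      threshold_snoc_above[OF assms(1-3), of k] assms(4) by (simp, cases k) auto
  moreover have "x \<notin> band n w k"
    using threshold_mono[OF assms(1), of "Suc k" d] assms(3,4) by (auto simp: band_def)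
  ultimately show ?thesis by (auto simp: band_def unread_snoc)
qed

lemma card_split_at:
  fixes A :: "nat set"
  assumes "finite A" "x \<in> A"
  shows "card A = Suc (card {y \<in> A. y < x} + card {y \<in> A. x < y})"
proof -
  have "insert x ({y \<in> A. y < x} \<union> {y \<in> A. x < y}) = A" using assms(2) by auto
  then have "card A = card (insert x ({y \<in> A. y < x} \<union> {y \<in> A. x < y}))"
    by (simp only:)
  also have "\<dots> = Suc (card ({y \<in> A. y < x} \<union> {y \<in> A. x < y}))"
    using assms(1) by simp
  also have "card ({y \<in> A. y < x} \<union> {y \<in> A. x < y}) = card {y \<in> A. y < x} + card {y \<in> A. x < y}"
    using assms(1) by (intro card_Un_disjoint) auto
  finally show ?thesis .
qed

lemma band_sizes_nth: "k < d \<Longrightarrow> band_sizes d n w ! k = card (band n w k)"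
  by (simp add: band_sizes_def)

lemma length_band_sizes [simp]: "length (band_sizes d n w) = d"
  by (simp add: band_sizes_def)

lemma last_band_sizes:
  assumes "1 \<le> d"
  shows "last (band_sizes d n w) = card (band n w (d - 1))"
  using assms by (simp add: band_sizes_def last_map)

text \<open>The \<open>p\<^sub>i - 1 - h\<close> letters above \<open>x\<close> pass to the next band, which is one of the counted bands
  since \<open>i + 1 < d\<close>.\<close>

lemma band_sizes_snoc_inner:
  assumes "set w \<subseteq> {1..n}" "x \<in> band n w i" "Suc i < d"
  shows "band_sizes d n (w @ [x]) = T_op i (card {y \<in> band n w i. y < x}) (band_sizes d n w)"
proof (rule nth_equalityI)
  let ?h = "card {y \<in> band n w i. y < x}"
  fix k assume "k < length (band_sizes d n (w @ [x]))"
  then have k: "k < d" by simp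
  have disj: "{y \<in> band n w i. x < y} \<inter> band n w (Suc i) = {}" by (auto simp: band_def)
  have "card (band n (w @ [x]) (Suc i)) = card {y \<in> band n w i. x < y} + card (band n w (Suc i))"
    unfolding band_snoc_next[OF assms(1,2)] by (rule card_Un_disjoint) (use disj in auto)
  then have next_card: "card (band n (w @ [x]) (Suc i)) =
      card (band n w (Suc i)) + (card (band n w i) - 1 - ?h)"
    unfolding card_split_at[OF finite_band assms(2)] by simp
  have T_nth: "T_op i ?h (band_sizes d n w) ! k =
      (if k = Suc i then card (band n w (Suc i)) + (card (band n w i) - 1 - ?h)
       else if k = i then ?h else card (band n w k))"
    using k assms(3) by (simp add: T_op_def band_sizes_nth nth_list_update)
  consider "k = Suc i" | "k = i" | "k \<noteq> i" "k \<noteq> Suc i" by blast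
  then show "band_sizes d n (w @ [x]) ! k = T_op i ?h (band_sizes d n w) ! k"
  proof cases
    case 1
    then show ?thesis unfolding T_nth band_sizes_nth[OF k] by (simp add: next_card)
  next
    case 2
    then show ?thesis
      unfolding T_nth band_sizes_nth[OF k] by (simp add: band_snoc_same[OF assms(1,2)])
  next
    case 3
    then show ?thesis
      unfolding T_nth band_sizes_nth[OF k] by (simp add: band_snoc_other[OF assms(1,2)])
  qed
qed (simp add: T_op_def)

text \<open>Here the letters above \<open>x\<close> leave the counted bands altogether: they end up above the new
  \<open>b\<^sub>d = x\<close>, that is, in the stack.\<close>

lemma band_sizes_snoc_last:
  assumes "set w \<subseteq> {1..n}" "1 \<le> d" "x \<in> band n w (d - 1)"
  shows "band_sizes d n (w @ [x]) = U_op (card {y \<in> band n w (d - 1). y < x}) (band_sizes d n w)"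
proof -
  obtain m where d: "d = Suc m" using assms(2) by (cases d) auto
  then have x: "x \<in> band n w m" using assms(3) by simp
  have "card (band n (w @ [x]) k) = card (band n w k)" if "k < m" for k
    using band_snoc_other[OF assms(1) x, of k] that by simp
  moreover have "card (band n (w @ [x]) m) = card {y \<in> band n w m. y < x}"
    by (simp only: band_snoc_same[OF assms(1) x])
  ultimately show ?thesis
    by (simp add: d U_op_def band_sizes_def)
qed

section \<open>Scan states and the stack of a legal prefix\<close>

lemma empty_notin_delete_empty: "{} \<notin> set (delete_empty S)"
  by (simp add: delete_empty_def)

lemma Union_delete_empty: "\<Union>(set (delete_empty S)) = \<Union>(set S)"
  by (auto simp: delete_empty_def)

lemma sorted_delete_empty: "sorted_wrt R S \<Longrightarrow> sorted_wrt R (delete_empty S)"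
  by (simp add: delete_empty_def sorted_wrt_filter)

lemma Union_head_tl: "head_or {} S \<union> \<Union>(set (tl S)) = \<Union>(set S)"
  by (cases S) (auto simp: head_or_def)

lemma legal_move_fst: "legal_move d n k x (\<sigma>, S) (\<tau>, T) \<Longrightarrow> \<tau> = \<sigma> @ [x]"
  by (auto elim: legal_move.cases)

text \<open>Only the merger lowers \<open>b\<^sub>d\<close>, namely to \<open>x\<close>, and the set \<open>E\<close> which it puts into the stack consists
  of the unread letters that this exposes. A split and a non-trigger move keep \<open>b\<^sub>d\<close>; the former
  removes just \<open>x\<close> from the union of the stack, the latter reads a letter below it.\<close>

lemma legal_move_preserves_scan_state:
  assumes "1 \<le> d" "legal_move d n k x s t"
  shows "scan_state d n t"
  using assms(2)
proof cases
  case (merger \<sigma> S E)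
  then have scan: "set \<sigma> \<subseteq> {1..n}" "distinct \<sigma>" "sorted_wrt set_before S"
    and un: "\<Union>(set S) = {x \<in> unread n \<sigma>. threshold n \<sigma> d < x}"
    by (auto simp: scan_state_def)
  have x: "x \<in> {1..n}" "x \<notin> set \<sigma>" using merger by (auto simp: unread_def)
  have thr: "threshold n (\<sigma> @ [x]) d = x"
    using merger assms(1) new_letter_trigger_iff[of x n \<sigma> d] by (simp add: threshold_snoc)
  have "\<forall>e\<in>E. \<forall>y\<in>\<Union>(set S). e < y" using un merger by auto
  then have "sorted_wrt set_before ((E \<union> head_or {} S) # tl S)"
    using scan(3) by (cases S) (auto simp: head_or_def set_before_def)
  moreover have "E \<union> \<Union>(set S) = {y \<in> unread n (\<sigma> @ [x]). x < y}"
  proof -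
    have "y < threshold n \<sigma> d \<or> threshold n \<sigma> d < y" if "y \<in> unread n \<sigma>" for y
      using threshold_not_unread[OF that assms(1)] by auto
    then show ?thesis
      unfolding un \<open>E = _\<close> unread_snoc using \<open>x < threshold n \<sigma> d\<close> by auto
  qed
  ultimately show ?thesis
    using scan x thr Union_head_tl[of S]
    by (simp add: merger(3) scan_state_def empty_notin_delete_empty Union_delete_empty
        sorted_delete_empty Un_assoc)
next
  case (split \<sigma> S I S')
  then have scan: "set \<sigma> \<subseteq> {1..n}" "distinct \<sigma>" "sorted_wrt set_before (I # S')"
    and un: "I \<union> \<Union>(set S') = {x \<in> unread n \<sigma>. threshold n \<sigma> d < x}"
    by (auto simp: scan_state_def)
  have x: "x \<in> {1..n}" "x \<notin> set \<sigma>" using split by (auto simp: unread_def)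
  have thr: "threshold n (\<sigma> @ [x]) d = threshold n \<sigma> d"
    using threshold_snoc_above[OF scan(1), of x d d] split assms(1) by simp
  have "sorted_wrt set_before ({y \<in> I. y < x} # {y \<in> I. x < y} # S')"
    using scan(3) by (auto simp: set_before_def)
  moreover have "{y \<in> I. y < x} \<union> ({y \<in> I. x < y} \<union> \<Union>(set S'))
      = {y \<in> unread n (\<sigma> @ [x]). threshold n (\<sigma> @ [x]) d < y}"
  proof -
    have "x \<notin> \<Union>(set S')" using scan(3) split by (auto simp: set_before_def)
    then have "{y \<in> I. y < x} \<union> ({y \<in> I. x < y} \<union> \<Union>(set S')) = (I \<union> \<Union>(set S')) - {x}" by auto
    then show ?thesis using un thr by (auto simp: unread_snoc)
  qed
  ultimately show ?thesis
    using scan x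
    by (simp add: split(3) scan_state_def empty_notin_delete_empty Union_delete_empty
        sorted_delete_empty)
next
  case (non_trigger \<sigma> S)
  then have scan: "set \<sigma> \<subseteq> {1..n}" by (auto simp: scan_state_def)
  have x: "x \<in> {1..n}" "x \<notin> set \<sigma>" using non_trigger by (auto simp: unread_def)
  note below = non_trigger_below_threshold[OF scan _ assms(1)]
  have "x < threshold n \<sigma> d" using below non_trigger by blast
  moreover have "threshold n (\<sigma> @ [x]) d = threshold n \<sigma> d"
    using below[of x] non_trigger assms(1) by (simp add: threshold_snoc)
  ultimately show ?thesis using non_trigger x
    by (auto simp: scan_state_def unread_snoc)
qed

lemma reachable_scan_state:
  assumes "1 \<le> d" "reachable d n s"
  shows "scan_state d n s"
  using assms(2)
proof induction
  case initial
  have "threshold n [] d = n + d" using is_trigger_in_set by (fastforce simp: threshold_def)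
  then show ?case by (auto simp: scan_state_def unread_def)
next
  case (step s k x t)
  then show ?case using legal_move_preserves_scan_state[OF assms(1)] by blast
qed

text \<open>The kinds are separated by whether \<open>x\<close> is a \<open>d\<close>-trigger and by its side of \<open>b\<^sub>d\<close>.\<close>

lemma legal_move_deterministic:
  "legal_move d n k x (\<sigma>, S) t \<Longrightarrow> legal_move d n k' x (\<sigma>, S) t' \<Longrightarrow> k = k' \<and> t = t'"
  by (auto elim!: legal_move.cases)

lemma reachable_snoc:
  assumes "reachable d n (\<sigma> @ [x], T)"
  shows "\<exists>S k. reachable d n (\<sigma>, S) \<and> legal_move d n k x (\<sigma>, S) (\<sigma> @ [x], T)"
  using assms
proof cases
  case (step s k y)
  obtain \<tau> S where s: "s = (\<tau>, S)" by fastforce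
  with step legal_move_fst have "\<sigma> @ [x] = \<tau> @ [y]" by blast
  with step s show ?thesis by auto
qed simp

text \<open>The last letter of the prefix must have been read by the last move, so a path to the prefix
  passes through a state for the prefix without it, and determinism applies step by step.\<close>

lemma reachable_unique: "reachable d n (\<sigma>, S) \<Longrightarrow> reachable d n (\<sigma>, T) \<Longrightarrow> S = T"
proof (induction \<sigma> arbitrary: S T rule: rev_induct)
  case Nil
  have "S = []" if "reachable d n ([], S)" for S
    using that by cases (auto elim: legal_move.cases)
  with Nil show ?case by auto
next
  case (snoc x \<sigma>)
  then obtain S' k T' k' where
    "reachable d n (\<sigma>, S')" "legal_move d n k x (\<sigma>, S') (\<sigma> @ [x], S)"
    "reachable d n (\<sigma>, T')" "legal_move d n k' x (\<sigma>, T') (\<sigma> @ [x], T)"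
    using reachable_snoc by meson
  with snoc.IH[of S' T'] show ?case using legal_move_deterministic by blast
qed

lemma stack_eqI: "reachable d n (\<sigma>, S) \<Longrightarrow> stack d n \<sigma> = S"
  unfolding stack_def using reachable_unique by blast

lemma legal_prefix_reachable: "legal_prefix d n \<sigma> \<Longrightarrow> reachable d n (\<sigma>, stack d n \<sigma>)"
  using stack_eqI by (auto simp: legal_prefix_def)

text \<open>It suffices to exhibit one legal move for a letter: it is then the only one, and its target is
  the stack of the extended prefix.\<close>

lemma legal_moves_of_letter:
  assumes "reachable d n (\<sigma>, S)" "legal_move d n k x (\<sigma>, S) (\<sigma> @ [x], T)"
  shows "stack d n (\<sigma> @ [x]) = T"
    and "legal_move d n k' x (\<sigma>, S) t \<longleftrightarrow> k' = k \<and> t = (\<sigma> @ [x], stack d n (\<sigma> @ [x]))"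
proof -
  show eq: "stack d n (\<sigma> @ [x]) = T"
    using assms reachable.step by (intro stack_eqI) blast
  show "legal_move d n k' x (\<sigma>, S) t \<longleftrightarrow> k' = k \<and> t = (\<sigma> @ [x], stack d n (\<sigma> @ [x]))"
    using assms(2) legal_move_deterministic[of d n k' x \<sigma> S t k] eq by blast
qed

section \<open>The layout\<close>

text \<open>Because blocks may be empty, \<open>set_before\<close> is not transitive, and comparing neighbouring blocks is
  not enough. The upper bound \<open>b\<^sub>m\<close> on all earlier letters, carried through the induction, replaces
  transitivity.\<close>

lemma sorted_bands_and_thresholds:
  assumes "set w \<subseteq> {1..n}"
  defines "blocks \<equiv> \<lambda>m. concat (map (\<lambda>i. [band n w i, {threshold n w (i + 1)}]) [0..<m])"
  shows "sorted_wrt set_before (blocks m) \<and> (\<forall>y \<in> \<Union>(set (blocks m)). y \<le> threshold n w m)"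
proof (induction m)
  case 0
  then show ?case by (simp add: blocks_def)
next
  case (Suc m)
  have blocks_Suc: "blocks (Suc m) = blocks m @ [band n w m, {threshold n w (Suc m)}]"
    by (simp add: blocks_def)
  have "m = 0 \<Longrightarrow> blocks m = []" by (simp add: blocks_def)
  moreover have "threshold n w m < threshold n w (Suc m)" if "m \<noteq> 0"
    using threshold_less_Suc[OF assms(1), of m] that by simp
  ultimately show ?case
    using Suc.IH unfolding blocks_Suc
    by (cases "m = 0") (fastforce simp: sorted_wrt_append set_before_def band_def)+
qed

lemma sorted_layout:
  assumes "scan_state d n (\<sigma>, stack d n \<sigma>)"
  shows "sorted_wrt set_before (layout d n \<sigma>)"
proof -
  have scan: "set \<sigma> \<subseteq> {1..n}" "sorted_wrt set_before (stack d n \<sigma>)"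
    and un: "\<Union>(set (stack d n \<sigma>)) = {x \<in> unread n \<sigma>. threshold n \<sigma> d < x}"
    using assms by (auto simp: scan_state_def)
  have "threshold n \<sigma> d < y" if "B \<in> set (stack d n \<sigma>)" "y \<in> B" for B y
    using that un by auto
  with sorted_bands_and_thresholds[OF scan(1), of d] scan(2) show ?thesis
    unfolding layout_def sorted_wrt_append set_before_def
    by (meson UnionI le_less_trans)
qed

section \<open>Stack sizes and the legal moves\<close>

lemma map_card_delete_empty:
  "\<forall>I\<in>set S. finite I \<Longrightarrow> map card (delete_empty S) = nz (map card S)"
  by (induction S) (auto simp: delete_empty_def nz_def)

lemma head_or_map_card: "head_or 0 (map card S) = card (head_or {} S)"
  by (cases S) (auto simp: head_or_def)

lemma scan_state_finite:
  assumes "scan_state d n (\<sigma>, S)" "I \<in> set S"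
  shows "finite I"
proof (rule finite_subset)
  show "I \<subseteq> unread n \<sigma>" using assms by (auto simp: scan_state_def)
qed simp

theorem proposition4p1:
  fixes d n :: nat and \<sigma> :: "nat list"
    and S :: "nat set list" and p L :: "nat list"
  assumes "d \<ge> 1"
    and "legal_prefix d n \<sigma>"
    and "S = stack d n \<sigma>"
    and "p = band_sizes d n \<sigma>"
    and "L = stack_sizes d n \<sigma>"
  shows
    "(scan_state d n (\<sigma>, S) \<and>
      \<Union>(set S) = {x \<in> unread n \<sigma>. threshold n \<sigma> d < x} \<and>
      sorted_wrt set_before (layout d n \<sigma>))
     \<and>
     (\<forall>i x h. i + 1 < d \<and> x \<in> band n \<sigma> i \<and> h = card {y \<in> band n \<sigma> i. y < x} \<longrightarrow>
        (\<forall>k t. legal_move d n k x (\<sigma>, S) t \<longleftrightarrow>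
                 k = Non_Trigger \<and> t = (\<sigma> @ [x], stack d n (\<sigma> @ [x]))) \<and>
        band_sizes d n (\<sigma> @ [x]) = T_op i h p \<and>
        stack_sizes d n (\<sigma> @ [x]) = L)
     \<and>
     (\<forall>x h. x \<in> band n \<sigma> (d - 1) \<and> h = card {y \<in> band n \<sigma> (d - 1). y < x} \<longrightarrow>
        (\<forall>k t. legal_move d n k x (\<sigma>, S) t \<longleftrightarrow>
                 k = Merger \<and> t = (\<sigma> @ [x], stack d n (\<sigma> @ [x]))) \<and>
        band_sizes d n (\<sigma> @ [x]) = U_op h p \<and>
        stack_sizes d n (\<sigma> @ [x]) = nz ((head_or 0 L + merge_gain h p) # tl L))
     \<and>
     (\<forall>x r. x \<in> head_or {} S \<and> r = local_rank (head_or {} S) x \<longrightarrow>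
        (\<forall>k t. legal_move d n k x (\<sigma>, S) t \<longleftrightarrow>
                 k = Split \<and> t = (\<sigma> @ [x], stack d n (\<sigma> @ [x]))) \<and>
        band_sizes d n (\<sigma> @ [x]) = p \<and>
        stack_sizes d n (\<sigma> @ [x]) = nz ((r - 1) # (head_or 0 L - r) # tl L))
     \<and>
     (\<forall>x k t. legal_move d n k x (\<sigma>, S) t \<longrightarrow>
        x \<in> (\<Union>i<d. band n \<sigma> i) \<union> head_or {} S)"
proof -
  have reach: "reachable d n (\<sigma>, S)"
    using legal_prefix_reachable assms by blast
  have scan: "scan_state d n (\<sigma>, S)"
    using reachable_scan_state[OF assms(1) reach] .
  then have word: "set \<sigma> \<subseteq> {1..n}"
    and un: "\<Union>(set S) = {x \<in> unread n \<sigma>. threshold n \<sigma> d < x}"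
    by (auto simp: scan_state_def)
  have L: "L = map card S" using assms by (simp add: stack_sizes_def)
  have fin: "\<forall>I\<in>set S. finite I" using scan_state_finite[OF scan] by blast
  have fin_head: "finite (head_or {} S)" using fin by (cases S) (auto simp: head_or_def)
  have fin_tl: "\<forall>I\<in>set (tl S). finite I" using fin by (cases S) auto

  have part_a: "scan_state d n (\<sigma>, S)"
    "\<Union>(set S) = {x \<in> unread n \<sigma>. threshold n \<sigma> d < x}"
    "sorted_wrt set_before (layout d n \<sigma>)"
    using scan un sorted_layout assms(3) by auto

  have inner: "(\<forall>k t. legal_move d n k x (\<sigma>, S) t \<longleftrightarrow>
                 k = Non_Trigger \<and> t = (\<sigma> @ [x], stack d n (\<sigma> @ [x]))) \<and>
        band_sizes d n (\<sigma> @ [x]) = T_op i h p \<and>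
        stack_sizes d n (\<sigma> @ [x]) = L"
    if i: "i + 1 < d" and x: "x \<in> band n \<sigma> i" and h: "h = card {y \<in> band n \<sigma> i. y < x}" for i x h
  proof -
    have unread: "x \<in> unread n \<sigma>" using x by (simp add: band_def)
    have "x < threshold n \<sigma> (d - 1)"
    proof (rule less_le_trans)
      show "x < threshold n \<sigma> (i + 1)" using x by (simp add: band_def)
      show "threshold n \<sigma> (i + 1) \<le> threshold n \<sigma> (d - 1)"
        using i by (intro threshold_mono[OF word]) auto
    qed
    then have "\<not> is_trigger d (\<sigma> @ [x]) x"
      using new_letter_trigger_iff[OF unread assms(1)] i by simp
    then have "legal_move d n Non_Trigger x (\<sigma>, S) (\<sigma> @ [x], S)"
      by (rule legal_move.non_trigger[OF scan unread])
    note moves = legal_moves_of_letter[OF reach this]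
    have "band_sizes d n (\<sigma> @ [x]) = T_op i h p"
      using band_sizes_snoc_inner[OF word x] i h assms(4) by simp
    with moves show ?thesis by (simp add: stack_sizes_def L)
  qed

  have merge: "(\<forall>k t. legal_move d n k x (\<sigma>, S) t \<longleftrightarrow>
                 k = Merger \<and> t = (\<sigma> @ [x], stack d n (\<sigma> @ [x]))) \<and>
        band_sizes d n (\<sigma> @ [x]) = U_op h p \<and>
        stack_sizes d n (\<sigma> @ [x]) = nz ((head_or 0 L + merge_gain h p) # tl L)"
    if x: "x \<in> band n \<sigma> (d - 1)" and h: "h = card {y \<in> band n \<sigma> (d - 1). y < x}" for x h
  proof -
    let ?E = "{y \<in> unread n \<sigma>. x < y \<and> y < threshold n \<sigma> d}"
    have unread: "x \<in> unread n \<sigma>" and less: "x < threshold n \<sigma> d"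
      and lower: "d = 1 \<or> threshold n \<sigma> (d - 1) < x"
      using x assms(1) by (auto simp: band_def)
    then have "is_trigger d (\<sigma> @ [x]) x"
      using new_letter_trigger_iff[OF unread assms(1)] by simp
    note moves = legal_moves_of_letter[OF reach legal_move.merger[OF scan unread this less refl]]
    \<comment> \<open>Nothing unread lies between \<open>x\<close> and \<open>b\<^sub>d\<close> except letters of the last band, so \<open>E\<close> is the
      part of that band that its size loses in addition to \<open>x\<close> itself.\<close>
    have E: "?E = {y \<in> band n \<sigma> (d - 1). x < y}"
      using lower assms(1) by (auto simp: band_def)
    have gain: "card ?E = merge_gain h p"
      using card_split_at[OF finite_band x] h
      by (simp add: E assms(4) merge_gain_def last_band_sizes[OF assms(1)])
    have "head_or {} S \<subseteq> {y. threshold n \<sigma> d < y}" using un Union_head_tl[of S] by blast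
    then have "?E \<inter> head_or {} S = {}" by auto
    then have "card (?E \<union> head_or {} S) = merge_gain h p + head_or 0 L"
      using fin_head by (simp add: card_Un_disjoint gain L head_or_map_card)
    then have "stack_sizes d n (\<sigma> @ [x]) = nz ((head_or 0 L + merge_gain h p) # tl L)"
      unfolding stack_sizes_def moves(1)
      by (subst map_card_delete_empty) (use fin_head fin_tl in \<open>auto simp: L map_tl add.commute\<close>)
    moreover have "band_sizes d n (\<sigma> @ [x]) = U_op h p"
      using band_sizes_snoc_last[OF word assms(1) x] h assms(4) by simp
    ultimately show ?thesis using moves(2) by blast
  qed

  have split: "(\<forall>k t. legal_move d n k x (\<sigma>, S) t \<longleftrightarrow>
                 k = Split \<and> t = (\<sigma> @ [x], stack d n (\<sigma> @ [x]))) \<and>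
        band_sizes d n (\<sigma> @ [x]) = p \<and>
        stack_sizes d n (\<sigma> @ [x]) = nz ((r - 1) # (head_or 0 L - r) # tl L)"
    if x: "x \<in> head_or {} S" and r: "r = local_rank (head_or {} S) x" for x r
  proof -
    obtain I S' where S: "S = I # S'" and xI: "x \<in> I"
      using x by (cases S) (auto simp: head_or_def)
    have unread: "x \<in> unread n \<sigma>" and above: "threshold n \<sigma> d < x"
      using un xI S by auto
    have "d = 1 \<or> threshold n \<sigma> (d - 1) < x"
      using threshold_mono[OF word, of "d - 1" d] above assms(1) by fastforce
    then have "is_trigger d (\<sigma> @ [x]) x"
      using new_letter_trigger_iff[OF unread assms(1)] by simp
    note moves = legal_moves_of_letter[OF reach legal_move.split[OF scan unread this above S xI]]
    have finI: "finite I" and finS': "\<forall>I\<in>set S'. finite I" using fin S by auto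
    \<comment> \<open>The local rank counts \<open>x\<close> itself, so the two new sets have sizes \<open>r - 1\<close> and \<open>\<ell>\<^sub>1 - r\<close>.\<close>
    have "{y \<in> I. y \<le> x} = insert x {y \<in> I. y < x}" using xI by auto
    then have r': "r = Suc (card {y \<in> I. y < x})"
      using finI r S by (simp add: local_rank_def head_or_def)
    have "stack_sizes d n (\<sigma> @ [x]) = nz ((r - 1) # (head_or 0 L - r) # tl L)"
      unfolding stack_sizes_def moves(1)
      by (subst map_card_delete_empty)
        (use finI finS' card_split_at[OF finI xI] r' S L in \<open>auto simp: head_or_def\<close>)
    moreover have "band_sizes d n (\<sigma> @ [x]) = p"
      using band_snoc_above[OF word unread above] assms(4) by (simp add: band_sizes_def)
    ultimately show ?thesis using moves(2) by blast
  qed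

  have only: "x \<in> (\<Union>i<d. band n \<sigma> i) \<union> head_or {} S" if "legal_move d n k x (\<sigma>, S) t" for x k t
  proof -
    have "x \<in> unread n \<sigma> \<and> (x < threshold n \<sigma> d \<or> x \<in> head_or {} S)"
      using that
    proof cases
      case non_trigger
      then show ?thesis using non_trigger_below_threshold[OF word _ assms(1)] by blast
    qed (auto simp: head_or_def)
    then show ?thesis using unread_below_threshold_in_band[OF _ assms(1)] by blast
  qed

  show ?thesis
    by (intro conjI part_a; intro allI impI; (elim conjE)?; rule inner merge split only; assumption)
qed

end
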